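(* Let $G=(V,E)$ be a graph as in the context with $|V|=n$, and let $t$ be a positive integer. For each $v\in V$, let $w^{(v)}_1,\dots,w^{(v)}_r$ be $r$ (independent) random walks from $v$, each stopped either when it hits a vertex of the color different from that of $v$ or when it has run for $t$ steps, whichever happens first. For $i=1,\dots,r$, let $b^{(v)}_i$ be the length of the walk $w^{(v)}_i$, and let $$\bar B(v)=\frac1r\sum_{i=1}^r b^{(v)}_i .$$ Let $\varepsilon,\delta\in(0,1)$. If $r\ge \frac{t^2}{\varepsilon^2}\ln\frac{2n}{\delta}$, then $$\mathbb P\left(\exists v\in V\ \text{s.t.}\ \left|\mathsf B^t_G(v)-\bar B(v)\right|>\varepsilon\right)<\delta ,$$ where the probability is over the choice of the random walks.
   Context: $G=(V,E)$ is a finite directed graph, each vertex is colored red or blue, with a right-stochastic transition matrix $M=(m_{ij})$, $m_{ij}=0$ if $(i,j)\notin E$. Random walks move according to $M$. $\bar C_v$ is the set of vertices of color different from that of $v$. The bubble radius of $v$ with exploration parameter $t$ is $\mathsf B^t_G(v)=\mathbb E_G[\min\{t,T_v(\bar C_v)\}]$, where $T_v(S)$ is the first time a random walk from $v$ hits $S$. *)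

theory Defs
  imports "HOL-Probability.Probability" "Graph_Theory.Pair_Digraph"
begin

datatype color = Red | Blue

text \<open>Loops are allowed. Only the entries of \<open>M\<close> indexed by vertices are meaningful.\<close>

locale walk_digraph = pair_fin_digraph G
  for G :: "'v pair_pre_digraph" +
  fixes M :: "'v \<Rightarrow> 'v \<Rightarrow> real"
  assumes M_nonneg: "\<lbrakk>u \<in> pverts G; w \<in> pverts G\<rbrakk> \<Longrightarrow> 0 \<le> M u w"
    and M_row_sum: "u \<in> pverts G \<Longrightarrow> (\<Sum>w\<in>pverts G. M u w) = 1"
    and M_non_arc: "\<lbrakk>u \<in> pverts G; w \<in> pverts G; (u, w) \<notin> parcs G\<rbrakk> \<Longrightarrow> M u w = 0"

text \<open>Trajectories are functions \<open>x :: nat \<Rightarrow> 'v\<close>, where \<open>x k\<close> is the position after \<open>k\<close> steps.\<close>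

abbreviation trajectory_space :: "'v pair_pre_digraph \<Rightarrow> (nat \<Rightarrow> 'v) measure" where
  "trajectory_space G \<equiv> Pi\<^sub>M UNIV (\<lambda>_. count_space (pverts G))"

text \<open>The conditional law of position \<open>k\<close>, given the positions \<open>x 0, \<dots>, x (k - 1)\<close>.\<close>

definition walk_kernel ::
    "'v pair_pre_digraph \<Rightarrow> ('v \<Rightarrow> 'v \<Rightarrow> real) \<Rightarrow> 'v \<Rightarrow> nat \<Rightarrow> (nat \<Rightarrow> 'v) \<Rightarrow> 'v measure" where
  "walk_kernel G M v k x =
     (case k of
        0 \<Rightarrow> return (count_space (pverts G)) v
      | Suc j \<Rightarrow> point_measure (pverts G) (\<lambda>w. ennreal (M (x j) w)))"

text \<open>The law of the infinite random walk from \<open>v\<close>, as the Ionescu-Tulcea limit of the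
  kernels above; \<open>emeasure_walk_law_path\<close> below gives its finite-dimensional distributions.\<close>

definition walk_law ::
    "'v pair_pre_digraph \<Rightarrow> ('v \<Rightarrow> 'v \<Rightarrow> real) \<Rightarrow> 'v \<Rightarrow> (nat \<Rightarrow> 'v) measure" where
  "walk_law G M v =
     projective_family.lim UNIV
       (Ionescu_Tulcea.CI (walk_kernel G M v) (\<lambda>_. count_space (pverts G)))
       (\<lambda>_. count_space (pverts G))"

definition random_walk ::
    "'a measure \<Rightarrow> 'v pair_pre_digraph \<Rightarrow> ('v \<Rightarrow> 'v \<Rightarrow> real) \<Rightarrow> 'v \<Rightarrow> ('a \<Rightarrow> nat \<Rightarrow> 'v) \<Rightarrow> bool" where
  "random_walk \<Omega> G M v X \<longleftrightarrow>
     X \<in> measurable \<Omega> (trajectory_space G) \<and> distr \<Omega> (trajectory_space G) X = walk_law G M v"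

definition opposite :: "'v pair_pre_digraph \<Rightarrow> ('v \<Rightarrow> color) \<Rightarrow> 'v \<Rightarrow> 'v set" where
  "opposite G c v = {u \<in> pverts G. c u \<noteq> c v}"

text \<open>The hitting time is \<open>\<infinity>\<close> if the set is never hit.\<close>

definition hitting_time :: "'v set \<Rightarrow> (nat \<Rightarrow> 'v) \<Rightarrow> enat" where
  "hitting_time S x = (INF k\<in>{k. x k \<in> S}. enat k)"

text \<open>The minimum below is at most \<open>t\<close>, so that \<open>the_enat\<close> is only applied to finite values.\<close>

definition bubble_radius ::
    "'v pair_pre_digraph \<Rightarrow> ('v \<Rightarrow> color) \<Rightarrow> ('v \<Rightarrow> 'v \<Rightarrow> real) \<Rightarrow> nat \<Rightarrow> 'v \<Rightarrow> real" where
  "bubble_radius G c M t v =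
     (\<integral>x. real (the_enat (min (enat t) (hitting_time (opposite G c v) x))) \<partial>walk_law G M v)"

text \<open>The number of steps made along \<open>x\<close> when stopping as soon as either \<open>S\<close> is hit or \<open>t\<close>
  steps have been made.\<close>

definition stopped_length :: "nat \<Rightarrow> 'v set \<Rightarrow> (nat \<Rightarrow> 'v) \<Rightarrow> nat" where
  "stopped_length t S x = (LEAST k. x k \<in> S \<or> k = t)"

context walk_digraph
begin

lemma Ionescu_Tulcea_walk_kernel:
  assumes v: "v \<in> pverts G"
  shows "Ionescu_Tulcea (walk_kernel G M v) (\<lambda>_. count_space (pverts G))"
proof (rule Ionescu_Tulcea.intro)
  let ?S = "\<lambda>_. count_space (pverts G)"
  have row: "prob_space (point_measure (pverts G) (\<lambda>w. ennreal (M u w)))"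
    if u: "u \<in> pverts G" for u
  proof (rule prob_spaceI)
    have "emeasure (point_measure (pverts G) (\<lambda>w. ennreal (M u w))) (pverts G)
        = (\<Sum>w\<in>pverts G. ennreal (M u w))"
      by (rule emeasure_point_measure_finite) (auto simp: pair_finite_verts)
    also have "\<dots> = ennreal (\<Sum>w\<in>pverts G. M u w)"
      using M_nonneg u by (intro sum_ennreal) auto
    finally show "emeasure (point_measure (pverts G) (\<lambda>w. ennreal (M u w)))
        (space (point_measure (pverts G) (\<lambda>w. ennreal (M u w)))) = 1"
      by (simp add: space_point_measure M_row_sum[OF u])
  qed
  show "walk_kernel G M v i \<in> measurable (PiM {0..<i} ?S) (subprob_algebra (?S i))" for i
  proof (cases i)
    case 0
    have "return (count_space (pverts G)) v \<in> space (subprob_algebra (count_space (pverts G)))"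
      using v by (auto simp: space_subprob_algebra intro!: prob_space_imp_subprob_space prob_space_return)
    then show ?thesis by (simp add: walk_kernel_def[abs_def] 0)
  next
    case (Suc j)
    have 1: "(\<lambda>u. point_measure (pverts G) (\<lambda>w. ennreal (M u w)))
        \<in> measurable (count_space (pverts G)) (subprob_algebra (count_space (pverts G)))"
      by (auto simp: space_subprob_algebra sets_point_measure
               intro!: prob_space_imp_subprob_space row)
    have 2: "(\<lambda>x. x j) \<in> measurable (PiM {0..<i} ?S) (count_space (pverts G))"
      by (rule measurable_component_singleton) (simp add: Suc)
    show ?thesis
      using measurable_compose[OF 2 1] by (simp add: walk_kernel_def[abs_def] Suc)
  qed
  show "prob_space (walk_kernel G M v i x)" if "x \<in> space (PiM {0..<i} ?S)" for i x
  proof (cases i)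
    case 0
    then show ?thesis using v by (auto simp: walk_kernel_def intro!: prob_space_return)
  next
    case (Suc j)
    then have "x j \<in> pverts G" using that by (auto simp: space_PiM PiE_iff)
    then show ?thesis using row by (simp add: walk_kernel_def Suc)
  qed
qed

lemma emeasure_walk_law_path:
  assumes v: "v \<in> pverts G" and p: "\<And>j. j \<le> k \<Longrightarrow> p j \<in> pverts G"
  shows "emeasure (walk_law G M v) {x \<in> space (trajectory_space G). \<forall>j\<le>k. x j = p j}
    = ennreal ((if p 0 = v then 1 else 0) * (\<Prod>j<k. M (p j) (p (Suc j))))"
proof -
  let ?S = "\<lambda>_::nat. count_space (pverts G)"
  interpret IT: Ionescu_Tulcea "walk_kernel G M v" ?S
    by (rule Ionescu_Tulcea_walk_kernel[OF v])
  let ?A = "\<lambda>k. {x \<in> space (PiM {0..<Suc k} ?S). \<forall>j\<le>k. x j = p j}"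
  let ?q = "\<lambda>k. (if p 0 = v then 1 else 0) * (\<Prod>j<k. M (p j) (p (Suc j)))"
  have A: "?A k \<in> sets (PiM {0..<Suc k} ?S)" for k
  proof -
    have "?A k = space (PiM {0..<Suc k} ?S) \<inter>
        (\<Inter>j\<in>{..k}. {x \<in> space (PiM {0..<Suc k} ?S). x j = p j})"
      by auto
    moreover have "{x \<in> space (PiM {0..<Suc k} ?S). x j = p j} \<in> sets (PiM {0..<Suc k} ?S)"
      if "j \<le> k" for j
    proof -
      have "(\<lambda>x. x j) \<in> measurable (PiM {0..<Suc k} ?S) (count_space (pverts G))"
        by (rule measurable_component_singleton) (use that in simp)
      from measurable_sets[OF this, of "{p j} \<inter> pverts G"]
      have "(\<lambda>x. x j) -` ({p j} \<inter> pverts G) \<inter> space (PiM {0..<Suc k} ?S)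
          \<in> sets (PiM {0..<Suc k} ?S)"
        by simp
      moreover have "(\<lambda>x. x j) -` ({p j} \<inter> pverts G) \<inter> space (PiM {0..<Suc k} ?S)
          = {x \<in> space (PiM {0..<Suc k} ?S). x j = p j}"
        using that by (auto simp: space_PiM PiE_iff extensional_def)
      ultimately show ?thesis by simp
    qed
    ultimately show ?thesis by (auto intro!: sets.Int sets.finite_INT)
  qed
  have main: "emeasure (IT.C 0 (Suc k) (\<lambda>_. undefined)) (?A k) = ennreal (?q k)"
    if "\<And>j. j \<le> k \<Longrightarrow> p j \<in> pverts G" for k
    using that
  proof (induction k)
    case 0
    let ?u = "\<lambda>_::nat. undefined :: 'v"
    have u: "?u \<in> space (PiM {0..<0} ?S)" by (simp add: space_PiM)
    have "IT.C 0 (Suc 0) ?u = IT.eP 0 ?u"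
      using bind_return[OF IT.measurable_eP u] by simp
    then have "emeasure (IT.C 0 (Suc 0) ?u) (?A 0)
        = walk_kernel G M v 0 ?u ((\<lambda>y. ?u(0 := y)) -` ?A 0 \<inter> space (count_space (pverts G)))"
      using IT.emeasure_eP[OF u A[of 0]] by (simp only:)
    also have "(\<lambda>y. ?u(0 := y)) -` ?A 0 \<inter> space (count_space (pverts G)) = {p 0}"
      using 0 by (auto simp: space_PiM PiE_iff extensional_def)
    also have "walk_kernel G M v 0 ?u {p 0} = ennreal (?q 0)"
      using 0 by (simp add: walk_kernel_def indicator_def)
    finally show ?case .
  next
    case (Suc k)
    note IT.C.simps [simp del]
    let ?u = "\<lambda>_::nat. undefined :: 'v"
    have u: "?u \<in> space (PiM {0..<0} ?S)" by (simp add: space_PiM)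
    have pk: "p k \<in> pverts G" "p (Suc k) \<in> pverts G" using Suc.prems by auto
    have ep: "emeasure (IT.eP (Suc k) x) (?A (Suc k))
        = ennreal (M (p k) (p (Suc k))) * indicator (?A k) x"
      if x: "x \<in> space (PiM {0..<Suc k} ?S)" for x
    proof -
      have "emeasure (IT.eP (Suc k) x) (?A (Suc k))
          = walk_kernel G M v (Suc k) x ((\<lambda>y. x(Suc k := y)) -` ?A (Suc k) \<inter> pverts G)"
        using IT.emeasure_eP[OF x A[of "Suc k"]] by simp
      also have "(\<lambda>y. x(Suc k := y)) -` ?A (Suc k) \<inter> pverts G
          = (if x \<in> ?A k then {p (Suc k)} else {})"
        using x pk by (auto simp: space_PiM PiE_iff extensional_def le_Suc_eq)
      also have "walk_kernel G M v (Suc k) x (if x \<in> ?A k then {p (Suc k)} else {})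
          = ennreal (M (p k) (p (Suc k))) * indicator (?A k) x"
        using pk by (auto simp: walk_kernel_def emeasure_point_measure_finite pair_finite_verts)
      finally show ?thesis .
    qed
    have sp: "space (IT.C 0 (Suc k) ?u) = space (PiM {0..<Suc k} ?S)"
      using IT.space_C[OF u, of "Suc k"] by simp
    have st: "sets (IT.C 0 (Suc k) ?u) = sets (PiM {0..<Suc k} ?S)"
      using IT.sets_C[OF u, of "Suc k"] by simp
    have ne: "space (IT.C 0 (Suc k) ?u) \<noteq> {}"
      using IT.prob_space_C[OF u] by (rule prob_space.not_empty)
    have mP: "IT.eP (Suc k) \<in> measurable (IT.C 0 (Suc k) ?u) (subprob_algebra (PiM {0..<Suc (Suc k)} ?S))"
      using IT.measurable_eP[of "Suc k"] by (simp only: measurable_cong_sets[OF st refl])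
    have "emeasure (IT.C 0 (Suc (Suc k)) ?u) (?A (Suc k))
        = emeasure (IT.C 0 (Suc k) ?u \<bind> IT.eP (Suc k)) (?A (Suc k))"
      by (simp add: IT.C.simps(2)[of 0 "Suc k"])
    also have "\<dots> = (\<integral>\<^sup>+x. emeasure (IT.eP (Suc k) x) (?A (Suc k)) \<partial>IT.C 0 (Suc k) ?u)"
      by (rule emeasure_bind[OF ne mP A])
    also have "\<dots> = (\<integral>\<^sup>+x. ennreal (M (p k) (p (Suc k))) * indicator (?A k) x \<partial>IT.C 0 (Suc k) ?u)"
      by (intro nn_integral_cong) (use ep sp in simp)
    also have "\<dots> = ennreal (M (p k) (p (Suc k))) * emeasure (IT.C 0 (Suc k) ?u) (?A k)"
      by (rule nn_integral_cmult_indicator) (use A st in simp)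
    also have "\<dots> = ennreal (M (p k) (p (Suc k))) * ennreal (?q k)"
      using Suc by simp
    also have "\<dots> = ennreal (?q (Suc k))"
      using M_nonneg pk Suc.prems
      by (subst ennreal_mult[symmetric]) (auto intro!: prod_nonneg simp: mult_ac)
    finally show ?case .
  qed
  have "{x \<in> space (trajectory_space G). \<forall>j\<le>k. x j = p j} = IT.PF.emb UNIV {0..<Suc k} (?A k)"
    by (auto simp: prod_emb_def space_PiM PiE_iff)
  then have "emeasure (walk_law G M v) {x \<in> space (trajectory_space G). \<forall>j\<le>k. x j = p j}
      = emeasure (IT.CI {0..<Suc k}) (?A k)"
    using IT.lim[OF _ A[of k]] by (simp add: walk_law_def)
  also have "\<dots> = emeasure (IT.C 0 (Suc k) (\<lambda>_. undefined)) (IT.PF.emb {0..<Suc k} {0..<Suc k} (?A k))"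
    by (rule IT.emeasure_CI[OF _ A]) simp
  also have "IT.PF.emb {0..<Suc k} {0..<Suc k} (?A k) = ?A k"
    by (rule prod_emb_id) (auto simp: space_PiM)
  finally show ?thesis using main[OF p] by simp
qed

end

end

theory Submission
  imports Defs
begin

text \<open>Hoeffding's inequality for the \<open>r\<close> walks from a fixed vertex bounds the failure probability
  there by \<open>2 exp (- 2 r \<epsilon>\<^sup>2 / t\<^sup>2) \<le> \<delta>\<^sup>2 / (2 n\<^sup>2)\<close>, and a union bound over the
  \<open>n\<close> vertices leaves \<open>\<delta>\<^sup>2 / (2 n) < \<delta>\<close>.\<close>

lemma stopped_length_le: "stopped_length t S x \<le> t"
  unfolding stopped_length_def by (rule Least_le) simp

text \<open>A least index for a disjunction is the smaller of the least indices for the two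
  disjuncts, and the disjunct \<open>k = t\<close> contributes \<open>t\<close>. This ties the
  bubble radius, defined by hitting times, to the lengths of the stopped walks, also when
  \<open>S\<close> is never hit.\<close>

lemma min_hitting_time_eq_stopped_length:
  "min (enat t) (hitting_time S x) = enat (stopped_length t S x)"
proof (rule antisym)
  \<comment> \<open>The index \<open>t\<close> satisfies the stopping condition, so the
    \<open>LEAST\<close> is attained.\<close>
  have "x (stopped_length t S x) \<in> S \<or> stopped_length t S x = t"
    unfolding stopped_length_def by (rule LeastI[of _ t]) simp
  then show "min (enat t) (hitting_time S x) \<le> enat (stopped_length t S x)"
    by (auto simp: hitting_time_def intro: min.coboundedI2 INF_lower)
  have "enat (stopped_length t S x) \<le> hitting_time S x"
    unfolding hitting_time_def stopped_length_def
    by (intro INF_greatest) (auto intro: Least_le)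
  then show "enat (stopped_length t S x) \<le> min (enat t) (hitting_time S x)"
    by (simp add: stopped_length_le)
qed

lemma bubble_radius_eq_integral_stopped_length:
  "bubble_radius G c M t v = (\<integral>x. real (stopped_length t (opposite G c v) x) \<partial>walk_law G M v)"
  by (simp add: bubble_radius_def min_hitting_time_eq_stopped_length)

text \<open>Each event \<open>x k \<in> S\<close> depends on a single coordinate with values in a
  discrete space, and a least index over countably many measurable predicates is measurable.\<close>

lemma measurable_stopped_length [measurable]:
  "stopped_length t S \<in> measurable (trajectory_space G) (count_space UNIV)"
proof -
  have "(\<lambda>x. x k \<in> S) \<in> measurable (trajectory_space G) (count_space UNIV)" for k
    by (rule measurable_compose[OF measurable_component_singleton]) simp_all
  then show ?thesis
    unfolding stopped_length_def[abs_def] by measurable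
qed

text \<open>Unbiasedness of a single sample: a change of variables moves the expectation from
  \<open>\<Omega>\<close> to the law of the walk.\<close>

lemma expectation_stopped_length_random_walk:
  assumes "random_walk \<Omega> G M v X"
  shows "(\<integral>\<omega>. real (stopped_length t (opposite G c v) (X \<omega>)) \<partial>\<Omega>) = bubble_radius G c M t v"
proof -
  have X: "X \<in> measurable \<Omega> (trajectory_space G)"
    and law: "distr \<Omega> (trajectory_space G) X = walk_law G M v"
    using assms by (auto simp: random_walk_def)
  have "bubble_radius G c M t v
      = (\<integral>x. real (stopped_length t (opposite G c v) x) \<partial>distr \<Omega> (trajectory_space G) X)"
    by (simp add: law bubble_radius_eq_integral_stopped_length)
  also have "\<dots> = (\<integral>\<omega>. real (stopped_length t (opposite G c v) (X \<omega>)) \<partial>\<Omega>)"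
    by (rule integral_distr[OF X]) measurable
  finally show ?thesis ..
qed

text \<open>Hoeffding's inequality for \<open>r\<close> independent variables with values in
  \<open>[0, t]\<close> and common mean \<open>bubble_radius G c M t v\<close>.\<close>

lemma bubble_radius_estimate_tail:
  fixes W :: "nat \<Rightarrow> 'a \<Rightarrow> nat \<Rightarrow> 'v"
  assumes "prob_space \<Omega>"
    and walk: "\<And>i. i \<in> {1..r} \<Longrightarrow> random_walk \<Omega> G M v (W i)"
    and indep: "prob_space.indep_vars \<Omega> (\<lambda>_. trajectory_space G) W {1..r}"
    and "0 < t" "0 < r" "0 \<le> \<epsilon>"
  shows "measure \<Omega> {\<omega> \<in> space \<Omega>. \<bar>bubble_radius G c M t v
            - (1 / real r) * (\<Sum>i = 1..r. real (stopped_length t (opposite G c v) (W i \<omega>)))\<bar> > \<epsilon>}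
         \<le> 2 * exp (- 2 * real r * \<epsilon>\<^sup>2 / (real t)\<^sup>2)"
proof -
  interpret prob_space \<Omega> by fact
  let ?B = "bubble_radius G c M t v"
  define X where "X = (\<lambda>i \<omega>. real (stopped_length t (opposite G c v) (W i \<omega>)))"
  interpret Hoeffding_ineq \<Omega> "{1..r}" X "\<lambda>_. 0" "\<lambda>_. real t" "real r * ?B"
  proof unfold_locales
    show "indep_vars (\<lambda>_. borel) X {1..r}"
      unfolding X_def by (rule indep_vars_compose2[OF indep]) measurable
    have "(\<Sum>i\<in>{1..r}. expectation (X i)) = (\<Sum>i\<in>{1..r}. ?B)"
      unfolding X_def by (intro sum.cong refl expectation_stopped_length_random_walk walk)
    then show "real r * ?B \<equiv> \<Sum>i\<in>{1..r}. expectation (X i)"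
      by simp
  qed (auto simp: X_def stopped_length_le)
  have [measurable]: "X i \<in> borel_measurable \<Omega>" if "i \<in> {1..r}" for i
    using that by (rule random_variable)
  \<comment> \<open>Hoeffding's inequality concerns the sum and a non-strict deviation, so the
    strict deviation of the average is scaled by \<open>r\<close> and weakened.\<close>
  have "\<epsilon> < \<bar>?B - (1 / real r) * s\<bar> \<Longrightarrow> real r * \<epsilon> \<le> \<bar>s - real r * ?B\<bar>" for s
  proof -
    assume less: "\<epsilon> < \<bar>?B - (1 / real r) * s\<bar>"
    have "real r * \<epsilon> \<le> real r * \<bar>?B - (1 / real r) * s\<bar>"
      using less by (intro mult_left_mono) auto
    also have "\<dots> = \<bar>real r * (?B - (1 / real r) * s)\<bar>"
      by (simp add: abs_mult)
    also have "\<dots> = \<bar>s - real r * ?B\<bar>"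
      using \<open>0 < r\<close> by (simp add: right_diff_distrib abs_minus_commute)
    finally show ?thesis .
  qed
  then have "prob {\<omega> \<in> space \<Omega>. \<bar>?B - (1 / real r) * (\<Sum>i = 1..r. X i \<omega>)\<bar> > \<epsilon>}
      \<le> prob {\<omega> \<in> space \<Omega>. \<bar>(\<Sum>i = 1..r. X i \<omega>) - real r * ?B\<bar> \<ge> real r * \<epsilon>}"
    by (intro finite_measure_mono) auto
  also have "\<dots> \<le> 2 * exp (- 2 * (real r * \<epsilon>)\<^sup>2 / (\<Sum>i\<in>{1..r}. (real t - 0)\<^sup>2))"
    using assms by (intro Hoeffding_ineq_abs_ge) auto
  \<comment> \<open>The squared ranges add up to \<open>r * t^2\<close>, which cancels one of the
    two factors \<open>r\<close> from the squared deviation.\<close>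
  also have "- 2 * (real r * \<epsilon>)\<^sup>2 / (\<Sum>i\<in>{1..r}. (real t - 0)\<^sup>2)
      = - 2 * real r * \<epsilon>\<^sup>2 / (real t)\<^sup>2"
    using \<open>0 < r\<close> \<open>0 < t\<close> by (simp add: power2_eq_square)
  finally show ?thesis by (simp add: X_def)
qed

theorem lemma4p3:
  fixes G :: "'v pair_pre_digraph"
    and c :: "'v \<Rightarrow> color"
    and M :: "'v \<Rightarrow> 'v \<Rightarrow> real"
    and \<Omega> :: "'a measure"
    and W :: "'v \<Rightarrow> nat \<Rightarrow> 'a \<Rightarrow> nat \<Rightarrow> 'v"
    and n t r :: nat
    and \<epsilon> \<delta> :: real
  assumes "walk_digraph G M"
    and "card (pverts G) = n"
    and "0 < t"
    and "prob_space \<Omega>"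
    and "\<And>v i. \<lbrakk>v \<in> pverts G; i \<in> {1..r}\<rbrakk> \<Longrightarrow> random_walk \<Omega> G M v (W v i)"
    and "\<And>v. v \<in> pverts G \<Longrightarrow>
           prob_space.indep_vars \<Omega> (\<lambda>_. trajectory_space G) (W v) {1..r}"
    and "0 < \<epsilon>" "\<epsilon> < 1"
    and "0 < \<delta>" "\<delta> < 1"
    and "real r \<ge> (real t)\<^sup>2 / \<epsilon>\<^sup>2 * ln (2 * real n / \<delta>)"
  shows "measure \<Omega> {\<omega> \<in> space \<Omega>. \<exists>v\<in>pverts G.
           \<bar>bubble_radius G c M t v
              - (1 / real r) * (\<Sum>i = 1..r. real (stopped_length t (opposite G c v) (W v i \<omega>)))\<bar> > \<epsilon>}
         < \<delta>"
\<comment> \<open>In the empty graph the logarithm bounding \<open>r\<close> is taken at 0, so this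
  case is treated apart; the bad event is then empty.\<close>
proof (cases "pverts G = {}")
  case True
  then show ?thesis using \<open>0 < \<delta>\<close> by simp
next
  case False
  interpret walk_digraph G M by fact
  interpret prob_space \<Omega> by fact
  have n: "0 < n"
    using False assms(2) pair_finite_verts by (auto simp: card_gt_0_iff)
  define L where "L = ln (2 * real n / \<delta>)"
  \<comment> \<open>This holds as \<open>\<delta> < 1 \<le> n\<close>. It makes \<open>L\<close>
    positive, hence \<open>r\<close> positive, so that \<open>1 / real r\<close> is a genuine
    reciprocal; it also gives the strict inequality at the end.\<close>
  have q: "1 < 2 * real n / \<delta>"
    using n \<open>0 < \<delta>\<close> \<open>\<delta> < 1\<close> by (simp add: field_simps)
  then have "0 < L" by (simp add: L_def)
  then have "0 < (real t)\<^sup>2 / \<epsilon>\<^sup>2 * L"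
    using \<open>0 < t\<close> \<open>0 < \<epsilon>\<close> by simp
  with assms(11) have r: "0 < r" by (simp add: L_def)
  let ?X = "\<lambda>v i \<omega>. real (stopped_length t (opposite G c v) (W v i \<omega>))"
  let ?E = "\<lambda>v. {\<omega> \<in> space \<Omega>.
    \<bar>bubble_radius G c M t v - (1 / real r) * (\<Sum>i = 1..r. ?X v i \<omega>)\<bar> > \<epsilon>}"
  have E: "?E v \<in> events" if v: "v \<in> pverts G" for v
  proof -
    have [measurable]: "W v i \<in> measurable \<Omega> (trajectory_space G)" if "i \<in> {1..r}" for i
      using assms(5)[OF v that] by (simp add: random_walk_def)
    show ?thesis by measurable
  qed
  have "L \<le> real r * \<epsilon>\<^sup>2 / (real t)\<^sup>2"
    using assms(11) \<open>0 < t\<close> \<open>0 < \<epsilon>\<close> by (simp add: L_def field_simps)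
  \<comment> \<open>Keeping the factor 2 of Hoeffding's exponent squares \<open>exp (- L)\<close>. A
    single factor \<open>exp (- L)\<close> would sum to exactly \<open>\<delta>\<close> over the
    vertices, without strictness.\<close>
  then have "exp (- 2 * real r * \<epsilon>\<^sup>2 / (real t)\<^sup>2) \<le> exp (- L) * exp (- L)"
    by (simp flip: exp_add)
  also have "exp (- L) = \<delta> / (2 * real n)"
    using q by (simp add: L_def exp_minus)
  finally have tail: "exp (- 2 * real r * \<epsilon>\<^sup>2 / (real t)\<^sup>2) \<le> (\<delta> / (2 * real n))\<^sup>2"
    by (simp add: power2_eq_square)
  have "{\<omega> \<in> space \<Omega>. \<exists>v\<in>pverts G.
      \<bar>bubble_radius G c M t v - (1 / real r) * (\<Sum>i = 1..r. ?X v i \<omega>)\<bar> > \<epsilon>}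
      = (\<Union>v\<in>pverts G. ?E v)" by auto
  \<comment> \<open>Subadditivity allows walks from different vertices to depend on each
    other.\<close>
  also have "prob \<dots> \<le> (\<Sum>v\<in>pverts G. prob (?E v))"
    using E pair_finite_verts by (intro finite_measure_subadditive_finite) auto
  also have "\<dots> \<le> (\<Sum>v\<in>pverts G. 2 * (\<delta> / (2 * real n))\<^sup>2)"
  proof (rule sum_mono)
    fix v assume "v \<in> pverts G"
    then have "prob (?E v) \<le> 2 * exp (- 2 * real r * \<epsilon>\<^sup>2 / (real t)\<^sup>2)"
      using assms(3,5,6) r \<open>0 < \<epsilon>\<close> by (intro bubble_radius_estimate_tail prob_space_axioms) auto
    with tail show "prob (?E v) \<le> 2 * (\<delta> / (2 * real n))\<^sup>2" by linarith
  qed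
  also have "\<dots> = \<delta> * (\<delta> / (2 * real n))"
    using n assms(2) by (simp add: power2_eq_square field_simps)
  also have "\<dots> < \<delta>"
    using q \<open>0 < \<delta>\<close> by (simp add: field_simps)
  finally show ?thesis .
qed

end
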